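(* For every graph $G$, $\mathrm{lcwd}(G)\le \ell(G)+1$, where $\mathrm{lcwd}(G)$ is the linear clique-width and $\ell(G)$ the lettericity of $G$.
   Context: Lettericity: for a finite alphabet $\Sigma$, decoder $\mathcal{P}\subseteq\Sigma^2$ and word $w=w_1\cdots w_n$ over $\Sigma$, the letter graph $G(\mathcal{P},w)$ has vertex set $\{1,\dots,n\}$ with $i<j$ adjacent iff $(w_i,w_j)\in\mathcal{P}$; $\ell(G)$ is the minimum $|\Sigma|$ such that $G$ is isomorphic to some $G(\mathcal{P},w)$ over $\Sigma$. Clique-width expressions build vertex-labelled graphs using the operations: (i) $i(v)$, creation of a new vertex $v$ with label $i$; (ii) $G\oplus H$, disjoint union of two labelled graphs; (iii) $\eta_{i,j}$ ($i\ne j$), adding all edges between vertices labelled $i$ and vertices labelled $j$; (iv) $\rho_{i\to j}$, renaming label $i$ to $j$. An expression using $k$ labels is a $k$-expression; it defines $G$ if the resulting graph, ignoring labels, is $G$. An expression is linear if in every disjoint union operation at least one of the two operands is a single newly created vertex $i(v)$ (equivalently, its expression tree is a caterpillar). The linear clique-width $\mathrm{lcwd}(G)$ is the minimum $k$ such that $G$ is defined by a linear $k$-expression. *)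

theory Defs
  imports "Graph_Theory.Graph_Theory"
begin

text \<open>
  A finite simple graph is a \<^locale>\<open>pair_graph\<close>: each undirected edge is represented by
  its two opposite arcs.
\<close>

definition letter_graph :: "('l \<times> 'l) set \<Rightarrow> 'l list \<Rightarrow> nat pair_pre_digraph" where
  "letter_graph P w =
    (let A = {(i, j). 1 \<le> i \<and> i < j \<and> j \<le> length w \<and> (w ! (i - 1), w ! (j - 1)) \<in> P}
     in \<lparr> pverts = {1..length w}, parcs = A \<union> A\<inverse> \<rparr>)"

text \<open>Any finite alphabet is in bijection with a set of natural numbers.\<close>

definition is_letter_graph_over :: "'a pair_pre_digraph \<Rightarrow> nat set \<Rightarrow> bool" where
  "is_letter_graph_over G \<Sigma> \<longleftrightarrow>
    (\<exists>P w. P \<subseteq> \<Sigma> \<times> \<Sigma> \<and> set w \<subseteq> \<Sigma> \<and>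
      digraph_iso (with_proj G) (with_proj (letter_graph P w)))"

definition lettericity :: "'a pair_pre_digraph \<Rightarrow> nat" where
  "lettericity G = (LEAST k. \<exists>\<Sigma>. finite \<Sigma> \<and> card \<Sigma> = k \<and> is_letter_graph_over G \<Sigma>)"

text \<open>The values of \<open>vlabel\<close> outside the vertex set carry no meaning.\<close>

record 'a labelled_graph = "'a pair_pre_digraph" +
  vlabel :: "'a \<Rightarrow> nat"

definition lg_vertex :: "nat \<Rightarrow> 'a \<Rightarrow> 'a labelled_graph" where
  "lg_vertex i v = \<lparr> pverts = {v}, parcs = {}, vlabel = (\<lambda>_. i) \<rparr>"

definition lg_union :: "'a labelled_graph \<Rightarrow> 'a labelled_graph \<Rightarrow> 'a labelled_graph" where
  "lg_union G H =
    \<lparr> pverts = pverts G \<union> pverts H,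
      parcs = parcs G \<union> parcs H,
      vlabel = (\<lambda>v. if v \<in> pverts G then vlabel G v else vlabel H v) \<rparr>"

definition lg_join :: "nat \<Rightarrow> nat \<Rightarrow> 'a labelled_graph \<Rightarrow> 'a labelled_graph" where
  "lg_join i j G =
    (let A = {(u, v). u \<in> pverts G \<and> v \<in> pverts G \<and> vlabel G u = i \<and> vlabel G v = j}
     in G\<lparr> parcs := parcs G \<union> A \<union> A\<inverse> \<rparr>)"

definition lg_rename :: "nat \<Rightarrow> nat \<Rightarrow> 'a labelled_graph \<Rightarrow> 'a labelled_graph" where
  "lg_rename i j G = G\<lparr> vlabel := (\<lambda>v. if vlabel G v = i then j else vlabel G v) \<rparr>"

datatype 'a cw_expr =
    Create nat 'a
  | DUnion "'a cw_expr" "'a cw_expr"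
  | Join nat nat "'a cw_expr"
  | Rename nat nat "'a cw_expr"

primrec cw_eval :: "'a cw_expr \<Rightarrow> 'a labelled_graph" where
  "cw_eval (Create i v) = lg_vertex i v"
| "cw_eval (DUnion e f) = lg_union (cw_eval e) (cw_eval f)"
| "cw_eval (Join i j e) = lg_join i j (cw_eval e)"
| "cw_eval (Rename i j e) = lg_rename i j (cw_eval e)"

text \<open>The side conditions: unions are disjoint, and joins are between distinct labels.\<close>

primrec cw_wf :: "'a cw_expr \<Rightarrow> bool" where
  "cw_wf (Create i v) \<longleftrightarrow> True"
| "cw_wf (DUnion e f) \<longleftrightarrow> cw_wf e \<and> cw_wf f \<and> pverts (cw_eval e) \<inter> pverts (cw_eval f) = {}"
| "cw_wf (Join i j e) \<longleftrightarrow> i \<noteq> j \<and> cw_wf e"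
| "cw_wf (Rename i j e) \<longleftrightarrow> cw_wf e"

primrec cw_labels :: "'a cw_expr \<Rightarrow> nat set" where
  "cw_labels (Create i v) = {i}"
| "cw_labels (DUnion e f) = cw_labels e \<union> cw_labels f"
| "cw_labels (Join i j e) = {i, j} \<union> cw_labels e"
| "cw_labels (Rename i j e) = {i, j} \<union> cw_labels e"

definition is_create :: "'a cw_expr \<Rightarrow> bool" where
  "is_create e \<longleftrightarrow> (\<exists>i v. e = Create i v)"

primrec cw_linear :: "'a cw_expr \<Rightarrow> bool" where
  "cw_linear (Create i v) \<longleftrightarrow> True"
| "cw_linear (DUnion e f) \<longleftrightarrow> cw_linear e \<and> cw_linear f \<and> (is_create e \<or> is_create f)"
| "cw_linear (Join i j e) \<longleftrightarrow> cw_linear e"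
| "cw_linear (Rename i j e) \<longleftrightarrow> cw_linear e"

definition k_expression :: "nat \<Rightarrow> 'a cw_expr \<Rightarrow> bool" where
  "k_expression k e \<longleftrightarrow> cw_wf e \<and> card (cw_labels e) = k"

text \<open>\<open>truncate\<close> forgets the labels.\<close>

definition cw_defines :: "'a cw_expr \<Rightarrow> 'a pair_pre_digraph \<Rightarrow> bool" where
  "cw_defines e G \<longleftrightarrow> pair_pre_digraph.truncate (cw_eval e) = G"

text \<open>
  Every expression creates a vertex, so none defines the graph without vertices; by convention
  that graph has linear clique-width 0.
\<close>

definition lcwd :: "'a pair_pre_digraph \<Rightarrow> nat" where
  "lcwd G = (if pverts G = {} then 0
    else LEAST k. \<exists>e. k_expression k e \<and> cw_linear e \<and> cw_defines e G)"

end

theory Submission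
  imports Defs
begin

text \<open>
  Read the word from left to right with one label per letter and one spare label. Each new vertex
  is created with the spare label, joined to the labels of those letters that the decoder pairs
  with the letter being read, and then renamed to that letter.
\<close>

text \<open>Tails and heads in \<open>with_proj\<close> are the projections \<open>fst\<close> and
  \<open>snd\<close>, so the arc map of an isomorphism is forced by its vertex map. Conversely, arcs
  are pairs of vertices, so injectivity on vertices carries over to arcs. This leaves a single
  vertex map \<open>f\<close> to work with.\<close>

lemma digraph_iso_with_proj_iff:
  assumes "pair_wf_digraph G"
  shows "digraph_iso (with_proj G) (with_proj H) \<longleftrightarrow>
    (\<exists>f. inj_on f (pverts G) \<and> pverts H = f ` pverts G \<and> parcs H = map_prod f f ` parcs G)"
proof
  assume "digraph_iso (with_proj G) (with_proj H)"
  then obtain h where h: "pre_digraph.digraph_isomorphism (with_proj G) h"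
    and H: "with_proj H = app_iso h (with_proj G)"
    unfolding digraph_iso_def by blast
  have tail: "iso_tail h = fst" and head: "iso_head h = snd"
    and verts: "pverts H = iso_verts h ` pverts G" and arcs: "parcs H = iso_arcs h ` parcs G"
    using H by (simp_all add: with_proj_def app_iso_def)
  have "iso_arcs h a = map_prod (iso_verts h) (iso_verts h) a" if "a \<in> parcs G" for a
    using h that by (auto simp: pre_digraph.digraph_isomorphism_def tail head prod_eq_iff)
  then have "parcs H = map_prod (iso_verts h) (iso_verts h) ` parcs G"
    unfolding arcs by (rule image_cong[OF refl])
  with h verts show "\<exists>f. inj_on f (pverts G) \<and> pverts H = f ` pverts G \<and>
      parcs H = map_prod f f ` parcs G"
    by (auto simp: pre_digraph.digraph_isomorphism_def)
next
  assume "\<exists>f. inj_on f (pverts G) \<and> pverts H = f ` pverts G \<and> parcs H = map_prod f f ` parcs G"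
  then obtain f where f: "inj_on f (pverts G)" "pverts H = f ` pverts G"
    "parcs H = map_prod f f ` parcs G"
    by blast
  define h where
    "h = \<lparr>iso_verts = f, iso_arcs = map_prod f f, iso_head = snd, iso_tail = fst\<rparr>"
  have "parcs G \<subseteq> pverts G \<times> pverts G"
    using assms by (auto dest: pair_wf_digraph.wellformed')
  then have "inj_on (map_prod f f) (parcs G)"
    using map_prod_inj_on[OF f(1) f(1)] inj_on_subset by blast
  then have "pre_digraph.digraph_isomorphism (with_proj G) h"
    using assms f(1) by (simp add: pre_digraph.digraph_isomorphism_def h_def wf_digraph_wp_iff)
  moreover have "with_proj H = app_iso h (with_proj G)"
    by (simp add: with_proj_def app_iso_def h_def f)
  ultimately show "digraph_iso (with_proj G) (with_proj H)"
    unfolding digraph_iso_def by blast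
qed

text \<open>Number the vertices, give each its own letter, and take adjacency itself as decoder.
  This guarantees that the minimum in \<open>lettericity\<close> ranges over a nonempty set.\<close>

lemma pair_graph_is_letter_graph:
  assumes "pair_graph G"
  shows "is_letter_graph_over G {1..card (pverts G)}"
proof -
  interpret pair_graph G by fact
  let ?n = "card (pverts G)"
  obtain f where f: "bij_betw f (pverts G) {1..?n}"
    using ex_bij_betw_nat_finite_1[OF pair_finite_verts] bij_betw_inv by blast
  define P where "P = map_prod f f ` parcs G"
  \<comment> \<open>Position \<open>i\<close> carries the letter \<open>i\<close>; positions start
    at 1, list indices at 0.\<close>
  define w where "w = [1..<Suc ?n]"
  have P: "P \<subseteq> {1..?n} \<times> {1..?n}"
    using f by (auto simp: P_def bij_betw_def dest: wellformed')
  have nth: "w ! (i - 1) = i" if "1 \<le> i" "i \<le> ?n" for i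
    using that by (simp add: w_def del: upt_Suc)
  have len: "length w = ?n"
    by (simp add: w_def del: upt_Suc)
  have sym: "(j, i) \<in> P" if "(i, j) \<in> P" for i j
    using that arcs_symmetric by (auto simp: P_def)
  have ne: "i \<noteq> j" if "(i, j) \<in> P" for i j
  proof -
    from that obtain u v where uv: "(u, v) \<in> parcs G" "i = f u" "j = f v"
      by (auto simp: P_def)
    then have "u \<noteq> v" using pair_no_loops by fastforce
    with uv f show ?thesis
      by (auto simp: bij_betw_def inj_on_def dest: wellformed')
  qed
  have "parcs (letter_graph P w) = P"
  proof -
    have "1 \<le> i \<and> i < j \<and> j \<le> length w \<and> (w ! (i - 1), w ! (j - 1)) \<in> P \<longleftrightarrow>
        (i, j) \<in> P \<and> i < j" for i j
    proof (cases "1 \<le> i \<and> i < j \<and> j \<le> ?n")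
      case True
      then show ?thesis using nth[of i] nth[of j] by (simp add: len)
    next
      case False
      then show ?thesis using P by (auto simp: len)
    qed
    then have "parcs (letter_graph P w) =
        {(i, j). (i, j) \<in> P \<and> i < j} \<union> {(i, j). (i, j) \<in> P \<and> i < j}\<inverse>"
      by (simp add: letter_graph_def Let_def)
    \<comment> \<open>A letter graph reads the decoder only on pairs \<open>i < j\<close>. Symmetry
      of \<open>P\<close> recovers the reversed pairs, and without loops there is nothing on the
      diagonal.\<close>
    also have "\<dots> = P"
      using sym ne by (auto simp: neq_iff)
    finally show ?thesis .
  qed
  moreover have "pverts (letter_graph P w) = f ` pverts G"
    using f by (simp add: letter_graph_def Let_def len bij_betw_def)
  ultimately have "digraph_iso (with_proj G) (with_proj (letter_graph P w))"
    using f unfolding digraph_iso_with_proj_iff[OF pair_wf_digraph] P_def bij_betw_def by blast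
  moreover have "set w \<subseteq> {1..?n}"
    by (auto simp: w_def)
  ultimately show ?thesis
    using P unfolding is_letter_graph_over_def by blast
qed

lemma lettericity_attained:
  assumes "pair_graph G"
  obtains \<Sigma> where "finite \<Sigma>" "card \<Sigma> = lettericity G" "is_letter_graph_over G \<Sigma>"
proof -
  have "\<exists>k \<Sigma>. finite \<Sigma> \<and> card \<Sigma> = k \<and> is_letter_graph_over G \<Sigma>"
    using pair_graph_is_letter_graph[OF assms] by blast
  from LeastI_ex[OF this] that show ?thesis
    unfolding lettericity_def by blast
qed

text \<open>A join treats one pair of labels, so the labels in \<open>L\<close> are joined to
  \<open>c\<close> one after another. Joins change neither vertices nor labels, hence the added arcs
  simply accumulate; \<open>c \<notin> L\<close> is the side condition of each join.\<close>

lemma join_with_label_set: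
  assumes "finite L" "c \<notin> L"
  shows "\<exists>e'. cw_labels e' \<subseteq> insert c L \<union> cw_labels e \<and>
    (cw_wf e \<longrightarrow> cw_wf e') \<and> (cw_linear e \<longrightarrow> cw_linear e') \<and>
    pverts (cw_eval e') = pverts (cw_eval e) \<and> vlabel (cw_eval e') = vlabel (cw_eval e) \<and>
    parcs (cw_eval e') = parcs (cw_eval e) \<union>
      (let A = {(u, v). u \<in> pverts (cw_eval e) \<and> v \<in> pverts (cw_eval e) \<and>
        vlabel (cw_eval e) u \<in> L \<and> vlabel (cw_eval e) v = c} in A \<union> A\<inverse>)"
  using assms
proof (induction L)
  case empty
  show ?case by (rule exI[of _ e]) (auto simp: Let_def)
next
  case (insert a L)
  then obtain e' where e': "cw_labels e' \<subseteq> insert c L \<union> cw_labels e"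
    "cw_wf e \<longrightarrow> cw_wf e'" "cw_linear e \<longrightarrow> cw_linear e'"
    "pverts (cw_eval e') = pverts (cw_eval e)" "vlabel (cw_eval e') = vlabel (cw_eval e)"
    "parcs (cw_eval e') = parcs (cw_eval e) \<union>
      (let A = {(u, v). u \<in> pverts (cw_eval e) \<and> v \<in> pverts (cw_eval e) \<and>
        vlabel (cw_eval e) u \<in> L \<and> vlabel (cw_eval e) v = c} in A \<union> A\<inverse>)"
    by auto
  show ?case
    using insert.prems
    by (intro exI[of _ "Join a c e'"]) (use e'(1) in \<open>auto simp: e'(2-) lg_join_def Let_def\<close>)
qed

text \<open>Here \<open>f\<close> gives the position of a vertex in the word and \<open>lab\<close>
  its letter. Positions matter only through their order, so the induction can pass to subsets of
  \<open>V\<close>, adding the vertex of largest position last. The invariant that every vertex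
  carries its letter as label keeps \<open>c\<close> free for the next vertex.\<close>

lemma linear_expression_of_ordered_letters:
  fixes f :: "'a \<Rightarrow> nat" and lab :: "'a \<Rightarrow> nat"
  assumes "finite V" "V \<noteq> {}" "inj_on f V" "lab ` V \<subseteq> \<Sigma>" "finite \<Sigma>" "c \<notin> \<Sigma>"
  shows "\<exists>e. cw_wf e \<and> cw_linear e \<and> cw_labels e \<subseteq> insert c \<Sigma> \<and> pverts (cw_eval e) = V \<and>
    (\<forall>v\<in>V. vlabel (cw_eval e) v = lab v) \<and>
    parcs (cw_eval e) =
      (let A = {(u, v). u \<in> V \<and> v \<in> V \<and> f u < f v \<and> (lab u, lab v) \<in> P} in A \<union> A\<inverse>)"
  using assms(1-4)
proof (induction V rule: finite_ranking_induct[where f = f])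
  case empty
  then show ?case by simp
next
  case (insert x V)
  show ?case
  \<comment> \<open>The ranking induction does not supply \<open>x \<notin> V\<close>. The
    construction really starts at a single vertex, since every expression creates one.\<close>
  proof (cases "V = {} \<or> x \<in> V")
    case True
    then consider "V = {}" | "insert x V = V" "V \<noteq> {}" by blast
    then show ?thesis
    proof cases
      case 1
      with insert.prems show ?thesis
        by (intro exI[of _ "Create (lab x) x"]) (auto simp: lg_vertex_def Let_def)
    next
      case 2
      with insert.IH insert.prems show ?thesis by simp
    qed
  next
    case False
    then have "V \<noteq> {}" "x \<notin> V" by auto
    have "inj_on f V" "lab ` V \<subseteq> \<Sigma>"
      using insert.prems by (auto simp: inj_on_insert)
    from insert.IH[OF \<open>V \<noteq> {}\<close> this] obtain e where e: "cw_wf e" "cw_linear e" "cw_labels e \<subseteq> insert c \<Sigma>"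
      "pverts (cw_eval e) = V" "\<forall>v\<in>V. vlabel (cw_eval e) v = lab v"
      "parcs (cw_eval e) =
        (let A = {(u, v). u \<in> V \<and> v \<in> V \<and> f u < f v \<and> (lab u, lab v) \<in> P} in A \<union> A\<inverse>)"
      by blast
    \<comment> \<open>The induction gives only \<open>\<le>\<close>; injectivity of \<open>f\<close>
      makes \<open>x\<close> strictly last.\<close>
    have less: "f v < f x" if "v \<in> V" for v
    proof -
      from that \<open>x \<notin> V\<close> insert.prems(2) have "f v \<noteq> f x" by (auto simp: inj_on_def)
      with insert.hyps that show ?thesis by (simp add: order_less_le)
    qed
    define d where "d = DUnion e (Create c x)"
    \<comment> \<open>The letters that the decoder pairs with that of \<open>x\<close> when
      \<open>x\<close> is the later vertex.\<close>
    define L where "L = {a \<in> \<Sigma>. (a, lab x) \<in> P}"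
    have L: "finite L" "c \<notin> L" "L \<subseteq> \<Sigma>"
      using assms by (auto simp: L_def)
    have lab: "lab x \<in> \<Sigma>" "\<And>v. v \<in> V \<Longrightarrow> lab v \<in> \<Sigma>" "\<And>v. v \<in> V \<Longrightarrow> lab v \<noteq> c"
      using insert.prems assms by auto
    have d: "cw_wf d" "cw_linear d" "cw_labels d \<subseteq> insert c \<Sigma>"
      "pverts (cw_eval d) = insert x V" "parcs (cw_eval d) = parcs (cw_eval e)"
      "vlabel (cw_eval d) x = c" "\<And>v. v \<in> V \<Longrightarrow> vlabel (cw_eval d) v = lab v"
      using e \<open>x \<notin> V\<close> by (auto simp: d_def lg_union_def lg_vertex_def is_create_def)
    obtain e' where e': "cw_labels e' \<subseteq> insert c L \<union> cw_labels d" "cw_wf e'" "cw_linear e'"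
      "pverts (cw_eval e') = insert x V" "vlabel (cw_eval e') = vlabel (cw_eval d)"
      "parcs (cw_eval e') = parcs (cw_eval d) \<union>
        (let A = {(u, v). u \<in> insert x V \<and> v \<in> insert x V \<and>
          vlabel (cw_eval d) u \<in> L \<and> vlabel (cw_eval d) v = c} in A \<union> A\<inverse>)"
      using join_with_label_set[OF L(1,2), of d] d(1,2) unfolding d(4) by metis
    have labels: "cw_labels e' \<subseteq> insert c \<Sigma>"
      using e'(1) d(3) L(3) by blast
    \<comment> \<open>At this moment \<open>x\<close> alone has label \<open>c\<close>, so the joins
      separate it from older vertices with the same letter.\<close>
    have new: "{(u, v). u \<in> insert x V \<and> v \<in> insert x V \<and>
        vlabel (cw_eval d) u \<in> L \<and> vlabel (cw_eval d) v = c} =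
        {(u, v). u \<in> V \<and> v = x \<and> (lab u, lab x) \<in> P}"
      using d(6,7) lab L(2) by (auto simp: L_def)
    \<comment> \<open>As \<open>x\<close> is last, it occurs only as the second entry of a new
      pair.\<close>
    have split: "{(u, v). u \<in> insert x V \<and> v \<in> insert x V \<and> f u < f v \<and> (lab u, lab v) \<in> P} =
        {(u, v). u \<in> V \<and> v \<in> V \<and> f u < f v \<and> (lab u, lab v) \<in> P} \<union>
        {(u, v). u \<in> V \<and> v = x \<and> (lab u, lab x) \<in> P}"
      using less by (auto dest: order_less_asym)
    show ?thesis
    \<comment> \<open>The renaming restores the invariant and releases \<open>c\<close>; older
      vertices are unaffected because their labels lie in \<open>\<Sigma>\<close>.\<close>
    proof (intro exI[of _ "Rename c (lab x) e'"] conjI ballI)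
      show "parcs (cw_eval (Rename c (lab x) e')) =
        (let A = {(u, v). u \<in> insert x V \<and> v \<in> insert x V \<and> f u < f v \<and> (lab u, lab v) \<in> P}
         in A \<union> A\<inverse>)"
      proof -
        have "parcs (cw_eval (Rename c (lab x) e')) = parcs (cw_eval e')"
          by (simp add: lg_rename_def)
        then show ?thesis
          unfolding e'(6) d(5) e(6) Let_def new split converse_Un by blast
      qed
    next
      show "cw_labels (Rename c (lab x) e') \<subseteq> insert c \<Sigma>"
        using labels lab(1) by simp
    next
      fix v assume "v \<in> insert x V"
      then show "vlabel (cw_eval (Rename c (lab x) e')) v = lab v"
        using d(6,7) lab(3) by (auto simp: lg_rename_def e'(5))
    qed (use e'(2-4) in \<open>simp_all add: lg_rename_def\<close>)
  qed
qed

lemma lcwd_le_card_labels: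
  assumes "cw_wf e" "cw_linear e" "cw_defines e G"
  shows "lcwd G \<le> card (cw_labels e)"
  using assms unfolding lcwd_def k_expression_def by (auto intro: Least_le)

theorem theorem9:
  fixes G :: "'a pair_pre_digraph"
  assumes "pair_graph G"
  shows "lcwd G \<le> lettericity G + 1"
proof (cases "pverts G = {}")
  case True
  then show ?thesis by (simp add: lcwd_def)
next
  case False
  interpret pair_graph G by fact
  obtain \<Sigma> where \<Sigma>: "finite \<Sigma>" "card \<Sigma> = lettericity G" "is_letter_graph_over G \<Sigma>"
    by (rule lettericity_attained[OF assms])
  then obtain P w where w: "set w \<subseteq> \<Sigma>"
    and iso: "digraph_iso (with_proj G) (with_proj (letter_graph P w))"
    unfolding is_letter_graph_over_def by blast
  obtain f where f: "inj_on f (pverts G)"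
    and verts: "pverts (letter_graph P w) = f ` pverts G"
    and arcs: "parcs (letter_graph P w) = map_prod f f ` parcs G"
    using iso unfolding digraph_iso_with_proj_iff[OF pair_wf_digraph] by blast
  \<comment> \<open>The letter at the position of \<open>v\<close>. The truncated subtraction is
    harmless, since positions are at least 1.\<close>
  define lab where "lab v = w ! (f v - 1)" for v
  have range: "1 \<le> f v" "f v \<le> length w" if "v \<in> pverts G" for v
  proof -
    have "f v \<in> {1..length w}"
      using imageI[OF that, of f] unfolding verts[symmetric] by (simp add: letter_graph_def Let_def)
    then show "1 \<le> f v" "f v \<le> length w" by simp_all
  qed
  have lab: "lab ` pverts G \<subseteq> \<Sigma>"
  proof
    fix a assume "a \<in> lab ` pverts G"
    then obtain v where v: "v \<in> pverts G" "a = w ! (f v - 1)" by (auto simp: lab_def)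
    have "f v - 1 < length w"
      using range[OF v(1)] by linarith
    with v(2) w show "a \<in> \<Sigma>" by auto
  qed
  obtain c where c: "c \<notin> \<Sigma>"
    using ex_new_if_finite[OF infinite_UNIV_nat \<Sigma>(1)] by blast
  let ?A = "{(u, v). u \<in> pverts G \<and> v \<in> pverts G \<and> f u < f v \<and> (lab u, lab v) \<in> P}"
  obtain e where e: "cw_wf e" "cw_linear e" "cw_labels e \<subseteq> insert c \<Sigma>"
    "pverts (cw_eval e) = pverts G" "parcs (cw_eval e) = ?A \<union> ?A\<inverse>"
    using linear_expression_of_ordered_letters[OF pair_finite_verts False f lab \<Sigma>(1) c, of P]
    unfolding Let_def by blast
  \<comment> \<open>On vertices of \<open>G\<close>, injectivity of \<open>f\<close> lets adjacency
    be read off in the letter graph; elsewhere both sides are false.\<close>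
  have "(u, v) \<in> ?A \<union> ?A\<inverse> \<longleftrightarrow> (u, v) \<in> parcs G" for u v
  proof (cases "u \<in> pverts G \<and> v \<in> pverts G")
    case True
    then have "(u, v) \<in> parcs G \<longleftrightarrow> (f u, f v) \<in> map_prod f f ` parcs G"
    proof (intro iffI)
      assume "(f u, f v) \<in> map_prod f f ` parcs G"
      then obtain a b where ab: "(a, b) \<in> parcs G" "f u = f a" "f v = f b"
        by auto
      with True have "u = a" "v = b"
        using inj_onD[OF f] wellformed'[OF ab(1)] by blast+
      with ab(1) show "(u, v) \<in> parcs G" by simp
    qed (metis image_eqI map_prod_simp)
    also have "\<dots> \<longleftrightarrow> (f u, f v) \<in> parcs (letter_graph P w)"
      by (simp only: arcs)
    also have "\<dots> \<longleftrightarrow> (u, v) \<in> ?A \<union> ?A\<inverse>"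
      using True range[of u] range[of v] by (auto simp: letter_graph_def Let_def lab_def)
    finally show ?thesis by simp
  qed (auto dest: wellformed')
  then have "parcs (cw_eval e) = parcs G"
    unfolding e(5) by auto
  then have "cw_defines e G"
    using e(4) by (simp add: cw_defines_def pair_pre_digraph.truncate_def)
  then have "lcwd G \<le> card (cw_labels e)"
    using e(1,2) lcwd_le_card_labels by blast
  \<comment> \<open>The spare label \<open>c\<close> accounts for the additional 1 in the
    bound.\<close>
  also have "\<dots> \<le> card (insert c \<Sigma>)"
    using \<Sigma>(1) e(3) by (intro card_mono) auto
  also have "\<dots> = lettericity G + 1"
    using \<Sigma>(1,2) c by simp
  finally show ?thesis .
qed

end
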